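(* Let $(X^m)_{m\in\mathbb{N}}\subset\mathcal{N}$ and $X\in\mathcal{N}$ be such that $X^m$ converges to $X$ in distribution. Then $X^m$ converges to $X$ almost everywhere on $(0,1)$.
   Context: A real random variable is neat if it is a monotonically increasing (nondecreasing) function $(0,1)\to\mathbb{R}$, where $(0,1)$ carries Lebesgue measure on its Borel $\sigma$-algebra; $\mathcal{N}$ is the set of neat random variables. *)

theory Defs
  imports "HOL-Probability.Probability"
begin

definition unit_space :: "real measure" where
  "unit_space = restrict_space lborel {0<..<1}"

text \<open>Random variables on \<open>(0,1)\<close> are represented by functions \<^typ>\<open>real \<Rightarrow> real\<close> whose values
  outside \<open>(0,1)\<close> are irrelevant. Measurability follows from monotonicity, see
  \<open>neat_measurable\<close> below.\<close>

definition neat :: "(real \<Rightarrow> real) set" where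
  "neat = {X. mono_on {0<..<1} X}"

definition converges_in_distribution ::
    "'a measure \<Rightarrow> (nat \<Rightarrow> 'a \<Rightarrow> real) \<Rightarrow> ('a \<Rightarrow> real) \<Rightarrow> bool" where
  "converges_in_distribution M Xs X \<longleftrightarrow>
     weak_conv_m (\<lambda>m. distr M borel (Xs m)) (distr M borel X)"

lemma prob_space_unit_space: "prob_space unit_space"
  unfolding unit_space_def by (rule prob_space_restrict_space) simp_all

lemma neat_measurable:
  assumes "X \<in> neat"
  shows "X \<in> borel_measurable unit_space"
proof -
  have "X \<in> borel_measurable (restrict_space borel {0<..<1})"
    using assms by (intro borel_measurable_mono_on_fnc) (simp add: neat_def)
  moreover have "sets unit_space = sets (restrict_space borel {0<..<1::real})"
    unfolding unit_space_def by (rule sets_restrict_space_cong) simp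
  ultimately show ?thesis
    using measurable_cong_sets by blast
qed

end

theory Submission
  imports Defs
begin

text \<open>The distribution function \<open>F\<close> of a neat \<open>Y\<close> is nearly an inverse of \<open>Y\<close>: \<open>Y u \<le> x\<close> forces
  \<open>u \<le> F x\<close>, and \<open>x < Y u\<close> forces \<open>F x \<le> u\<close>. If \<open>u\<close> is a continuity point of \<open>X\<close> and \<open>r < X u\<close>, then
  \<open>r < X w\<close> for some \<open>w < u\<close>, and a continuity point \<open>x\<close> of \<open>F\<^sub>X\<close> between \<open>r\<close> and \<open>X w\<close> satisfies
  \<open>F\<^sub>X x \<le> w < u\<close>; so the distribution function of \<open>X\<^sup>m\<close> is eventually below \<open>u\<close> at \<open>x\<close>, that is
  \<open>X\<^sup>m u > x > r\<close>. The upper bound is symmetric, and a monotone function has only countably many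
  discontinuities.\<close>

lemma cdf_distr_unit_space:
  assumes "Y \<in> neat"
  shows "cdf (distr unit_space borel Y) x = measure unit_space {v \<in> {0<..<1}. Y v \<le> x}"
proof -
  have "Y -` {..x} \<inter> space unit_space = {v \<in> {0<..<1}. Y v \<le> x}"
    by (auto simp: unit_space_def space_restrict_space)
  then show ?thesis
    using neat_measurable[OF assms] by (simp add: cdf_def measure_distr)
qed

lemma measure_unit_space_Ioc:
  assumes "0 < u" "u < 1"
  shows "measure unit_space {0<..u} = u"
  using assms by (subst unit_space_def, subst measure_restrict_space) auto

lemma neat_sublevel_sets:
  assumes "Y \<in> neat"
  shows "{v \<in> {0<..<1}. Y v \<le> x} \<in> sets unit_space"
proof -
  have "Y -` {..x} \<inter> space unit_space \<in> sets unit_space"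
    using neat_measurable[OF assms] by (rule measurable_sets) simp
  moreover have "Y -` {..x} \<inter> space unit_space = {v \<in> {0<..<1}. Y v \<le> x}"
    by (auto simp: unit_space_def space_restrict_space)
  ultimately show ?thesis by simp
qed

text \<open>By monotonicity the sublevel set of \<open>Y\<close> at \<open>x\<close> contains
  \<open>{0<..u}\<close>, which has measure \<open>u\<close>.\<close>

lemma le_cdf_neat:
  assumes "Y \<in> neat" "0 < u" "u < 1" "Y u \<le> x"
  shows "u \<le> cdf (distr unit_space borel Y) x"
proof -
  interpret prob_space unit_space by (rule prob_space_unit_space)
  have "Y v \<le> x" if "0 < v" "v \<le> u" for v
    using assms that mono_onD[of "{0<..<1}" Y v u] by (auto simp: neat_def)
  then have "measure unit_space {0<..u} \<le> measure unit_space {v \<in> {0<..<1}. Y v \<le> x}"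
    using assms by (intro finite_measure_mono neat_sublevel_sets) auto
  then show ?thesis
    using assms by (simp add: measure_unit_space_Ioc cdf_distr_unit_space)
qed

text \<open>Any \<open>v > u\<close> has \<open>Y v \<ge> Y u > x\<close>, so the sublevel set lies
  inside \<open>{0<..u}\<close>.\<close>

lemma cdf_neat_le:
  assumes "Y \<in> neat" "0 < u" "u < 1" "x < Y u"
  shows "cdf (distr unit_space borel Y) x \<le> u"
proof -
  interpret prob_space unit_space by (rule prob_space_unit_space)
  have "v \<le> u" if "0 < v" "v < 1" "Y v \<le> x" for v
    using assms that mono_onD[of "{0<..<1}" Y u v] by (force simp: neat_def)
  moreover have "{0<..u} \<in> sets unit_space"
    using assms by (auto simp: unit_space_def sets_restrict_space_iff)
  ultimately have "measure unit_space {v \<in> {0<..<1}. Y v \<le> x} \<le> measure unit_space {0<..u}"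
    by (intro finite_measure_mono) auto
  then show ?thesis
    using assms by (simp add: measure_unit_space_Ioc cdf_distr_unit_space)
qed

text \<open>Countably many discontinuities cannot fill an interval. Such points are needed because
  weak convergence controls distribution functions only where the limit is continuous.\<close>

lemma (in finite_borel_measure) isCont_cdf_between:
  assumes "a < b"
  obtains x where "a < x" "x < b" "isCont (cdf M) x"
proof -
  have "countable {x. \<not> isCont (cdf M) x}"
    by (intro mono_ctble_discont monoI cdf_nondecreasing)
  then obtain x where "x \<in> {a<..<b}" "x \<notin> {x. \<not> isCont (cdf M) x}"
    using open_minus_countable[of "{x. \<not> isCont (cdf M) x}" "{a<..<b}"] assms by auto
  then show ?thesis
    using that by auto
qed

lemma neat_tendsto_at_isCont:
  assumes Xs: "\<And>m. Xs m \<in> neat" and X: "X \<in> neat"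
    and conv: "converges_in_distribution unit_space Xs X"
    and u: "0 < u" "u < 1" and cont: "isCont X u"
  shows "(\<lambda>m. Xs m u) \<longlonglongrightarrow> X u"
proof -
  interpret \<Omega>: prob_space unit_space by (rule prob_space_unit_space)
  interpret D: real_distribution "distr unit_space borel X"
    by (intro \<Omega>.real_distribution_distr neat_measurable X)
  have cdf_conv: "(\<lambda>m. cdf (distr unit_space borel (Xs m)) x) \<longlonglongrightarrow> cdf (distr unit_space borel X) x"
    if "isCont (cdf (distr unit_space borel X)) x" for x
    using conv that by (simp add: converges_in_distribution_def weak_conv_m_def weak_conv_def)
  show ?thesis
  proof (rule order_tendstoI)
    fix r assume "r < X u"
    then have "\<forall>\<^sub>F w in at_left u. r < X w"
      using cont by (auto simp: isCont_def filterlim_at_split dest: order_tendstoD)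
    moreover have "\<forall>\<^sub>F w in at_left u. w \<in> {0<..<u}"
      using u eventually_at_left_real by blast
    ultimately have "\<forall>\<^sub>F w in at_left u. r < X w \<and> w \<in> {0<..<u}"
      by (rule eventually_conj)
    then obtain w where w: "r < X w" "0 < w" "w < u"
      using eventually_happens'[OF trivial_limit_at_left_real] by force
    obtain x where x: "r < x" "x < X w" "isCont (cdf (distr unit_space borel X)) x"
      using D.isCont_cdf_between[OF w(1)] by blast
    \<comment> \<open>The detour through \<open>w < u\<close> makes this inequality strict, so it
      passes to the distribution functions of \<open>Xs m\<close> for large
      \<open>m\<close>.\<close>
    have "cdf (distr unit_space borel X) x < u"
      using cdf_neat_le[OF X, of w x] w x u by linarith
    then have "\<forall>\<^sub>F m in sequentially. cdf (distr unit_space borel (Xs m)) x < u"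
      using order_tendstoD(2)[OF cdf_conv[OF x(3)]] by blast
    then show "\<forall>\<^sub>F m in sequentially. r < Xs m u"
    proof eventually_elim
      case (elim m)
      then show ?case
        using le_cdf_neat[OF Xs u, of m x] x by linarith
    qed
  next
    fix r assume "X u < r"
    then have "\<forall>\<^sub>F w in at_right u. X w < r"
      using cont by (auto simp: isCont_def filterlim_at_split dest: order_tendstoD)
    moreover have "\<forall>\<^sub>F w in at_right u. w \<in> {u<..<1}"
      using u eventually_at_right_real by blast
    ultimately have "\<forall>\<^sub>F w in at_right u. X w < r \<and> w \<in> {u<..<1}"
      by (rule eventually_conj)
    then obtain w where w: "X w < r" "u < w" "w < 1"
      using eventually_happens'[OF trivial_limit_at_right_real] by force
    obtain x where x: "X w < x" "x < r" "isCont (cdf (distr unit_space borel X)) x"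
      using D.isCont_cdf_between[OF w(1)] by blast
    have "u < cdf (distr unit_space borel X) x"
      using le_cdf_neat[OF X, of w x] w x u by linarith
    then have "\<forall>\<^sub>F m in sequentially. u < cdf (distr unit_space borel (Xs m)) x"
      using order_tendstoD(1)[OF cdf_conv[OF x(3)]] by blast
    then show "\<forall>\<^sub>F m in sequentially. Xs m u < r"
    proof eventually_elim
      case (elim m)
      \<comment> \<open>If \<open>x < Xs m u\<close>, then \<open>cdf_neat_le\<close> would bound
        the distribution function by \<open>u\<close>; hence
        \<open>Xs m u \<le> x < r\<close>.\<close>
      then show ?case
        using cdf_neat_le[OF Xs u, of x m] x by linarith
    qed
  qed
qed

theorem lemma5:
  fixes Xs :: "nat \<Rightarrow> real \<Rightarrow> real" and X :: "real \<Rightarrow> real"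
  assumes "\<And>m. Xs m \<in> neat" and "X \<in> neat"
    and "converges_in_distribution unit_space Xs X"
  shows "AE u in unit_space. (\<lambda>m. Xs m u) \<longlonglongrightarrow> X u"
proof -
  \<comment> \<open>As the interval is open, \<open>isCont\<close> at its points does not depend on
    the values of \<open>X\<close> outside.\<close>
  have "countable {u \<in> {0<..<1}. \<not> isCont X u}"
    using assms(2) by (intro mono_on_ctble_discont_open) (auto simp: neat_def)
  then have "AE u in lborel. u \<notin> {u \<in> {0<..<1}. \<not> isCont X u}"
    by (intro AE_not_in countable_imp_null_set_lborel)
  then have "AE u in lborel. u \<in> {0<..<1} \<longrightarrow> (\<lambda>m. Xs m u) \<longlonglongrightarrow> X u"
    by eventually_elim (use neat_tendsto_at_isCont[OF assms] in auto)
  then show ?thesis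
    unfolding unit_space_def by (subst AE_restrict_space_iff) auto
qed

end
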